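(* Let $\mathbf a=(a_1,\dots,a_N)'\in\mathbb R^N$ and $\mathbf d=(d_1,\dots,d_N)'\in\mathbb R^N$ satisfy $a_1\le\dots\le a_N$, $d_1\le\dots\le d_N$ and $a_i<d_i$ for all $i$, and let $k_i,h_i$ ($i\in\mathcal N$) be the indices associated with $(\mathbf a,\mathbf d)$ as defined in the context. Then the system of dynamics equations $$1=\int_{a_i}^{d_i}\Big[\beta-\alpha\Big(\sum_{j=1}^N \mathbf 1\{t\in[a_j,d_j]\}-1\Big)\Big]dt,\qquad i\in\mathcal N,$$ can be expressed equivalently as $$(\beta-\alpha(k_i-i))\,d_i-\alpha\sum_{j=h_i}^{i-1}d_j-(\beta-\alpha(i-h_i))\,a_i+\alpha\sum_{j=i+1}^{k_i}a_j=1,\qquad i\in\mathcal N,$$ or, alternatively, as $D\,\mathbf d-A\,\mathbf a=\mathbf 1$, where $\mathbf 1\in\mathbb R^N$ is the all-ones vector and $A,D\in\mathbb R^{N\times N}$ are given by $$A_{ij}=\begin{cases}\beta-\alpha(i-h_i), & i=j,\\ -\alpha, & i+1\le j\le k_i,\\ 0,&\text{otherwise,}\end{cases}\qquad D_{ij}=\begin{cases}\beta-\alpha(k_i-i), & i=j,\\ -\alpha, & h_i\le j\le i-1,\\ 0,&\text{otherwise.}\end{cases}$$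
   Context: $N\ge1$ is an integer, $\mathcal N=\{1,\dots,N\}$, and $\alpha,\beta>0$ satisfy $N<\beta/\alpha+1$. Here $a_i$ and $d_i$ are the arrival and departure times of user $i$; each user has service demand $1$ and, when $q$ users are present, every user is served at rate $\beta-\alpha(q-1)$. Conventions: $a_0=d_0=-\infty$, $a_{N+1}=d_{N+1}=\infty$, and a sum whose initial index exceeds its final index equals $0$. For $i\in\mathcal N$ define $$k_i=\max\{k\in\mathcal N: a_k\le d_i\},\qquad h_i=\min\{h\in\mathcal N: d_h\ge a_i\}.$$ *)

theory Defs
  imports "HOL-Analysis.Henstock_Kurzweil_Integration" "Jordan_Normal_Form.Matrix"
begin

(* The matrix library indexes vectors from 0, whereas users are numbered 1, ..., N. *)
abbreviation user_entry :: "real vec \<Rightarrow> nat \<Rightarrow> real"  ("_\<langle>_\<rangle>" [1000, 0] 1000) where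
  "v\<langle>i\<rangle> \<equiv> vec_index v (i - 1)"

definition k_index :: "nat \<Rightarrow> real vec \<Rightarrow> real vec \<Rightarrow> nat \<Rightarrow> nat" where
  "k_index N a d i = Max {k \<in> {1..N}. a\<langle>k\<rangle> \<le> d\<langle>i\<rangle>}"

definition h_index :: "nat \<Rightarrow> real vec \<Rightarrow> real vec \<Rightarrow> nat \<Rightarrow> nat" where
  "h_index N a d i = Min {h \<in> {1..N}. d\<langle>h\<rangle> \<ge> a\<langle>i\<rangle>}"

(* The number q of users present at time t, service periods being closed intervals. *)
definition num_present :: "nat \<Rightarrow> real vec \<Rightarrow> real vec \<Rightarrow> real \<Rightarrow> real" where
  "num_present N a d t = (\<Sum>j=1..N. indicator {a\<langle>j\<rangle>..d\<langle>j\<rangle>} t)"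

(* Row r and column c of the library matrices belong to users r + 1 and c + 1. *)
definition A_matrix :: "nat \<Rightarrow> real \<Rightarrow> real \<Rightarrow> real vec \<Rightarrow> real vec \<Rightarrow> real mat" where
  "A_matrix N \<alpha> \<beta> a d = mat N N (\<lambda>(r, c).
     let i = r + 1; j = c + 1 in
     if i = j then \<beta> - \<alpha> * (real i - real (h_index N a d i))
     else if i + 1 \<le> j \<and> j \<le> k_index N a d i then - \<alpha>
     else 0)"

definition D_matrix :: "nat \<Rightarrow> real \<Rightarrow> real \<Rightarrow> real vec \<Rightarrow> real vec \<Rightarrow> real mat" where
  "D_matrix N \<alpha> \<beta> a d = mat N N (\<lambda>(r, c).
     let i = r + 1; j = c + 1 in
     if i = j then \<beta> - \<alpha> * (real (k_index N a d i) - real i)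
     else if h_index N a d i \<le> j \<and> j \<le> i - 1 then - \<alpha>
     else 0)"

definition dynamics_system :: "nat \<Rightarrow> real \<Rightarrow> real \<Rightarrow> real vec \<Rightarrow> real vec \<Rightarrow> bool" where
  "dynamics_system N \<alpha> \<beta> a d \<longleftrightarrow>
     (\<forall>i\<in>{1..N}. 1 = integral {a\<langle>i\<rangle>..d\<langle>i\<rangle>} (\<lambda>t. \<beta> - \<alpha> * (num_present N a d t - 1)))"

definition linear_system :: "nat \<Rightarrow> real \<Rightarrow> real \<Rightarrow> real vec \<Rightarrow> real vec \<Rightarrow> bool" where
  "linear_system N \<alpha> \<beta> a d \<longleftrightarrow>
     (\<forall>i\<in>{1..N}.
        (\<beta> - \<alpha> * (real (k_index N a d i) - real i)) * d\<langle>i\<rangle>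
        - \<alpha> * (\<Sum>j=h_index N a d i..i - 1. d\<langle>j\<rangle>)
        - (\<beta> - \<alpha> * (real i - real (h_index N a d i))) * a\<langle>i\<rangle>
        + \<alpha> * (\<Sum>j=i + 1..k_index N a d i. a\<langle>j\<rangle>) = 1)"

end

theory Submission
  imports Defs
begin

text \<open>
  During the service of user \<open>i\<close>, user \<open>j\<close> is present for a time
  \<open>max 0 (min d\<^sub>i d\<^sub>j - max a\<^sub>i a\<^sub>j)\<close>. By monotonicity this is
  \<open>d\<^sub>j - a\<^sub>i\<close> for \<open>h\<^sub>i \<le> j < i\<close>, \<open>d\<^sub>i - a\<^sub>j\<close> for
  \<open>i < j \<le> k\<^sub>i\<close>, and \<open>0\<close> outside \<open>h\<^sub>i, \<dots>, k\<^sub>i\<close>;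
  summing over \<open>j\<close> evaluates the integral.
\<close>

section \<open>Monotone sequences and integrals of interval indicators\<close>

lemma le_of_steps:
  fixes f :: "nat \<Rightarrow> real"
  assumes "\<forall>i\<in>{m..<n}. f i \<le> f (i + 1)" "m \<le> i" "i \<le> j" "j \<le> n"
  shows "f i \<le> f j"
  using assms(3,4)
proof (induction j rule: dec_induct)
  case (step j)
  have "f j \<le> f (j + 1)" using assms(1,2) step.hyps step.prems by auto
  then show ?case using step by auto
qed simp

text \<open>Two closed intervals meet in \<open>{max p u..min q v}\<close>, so the value is the
  length of the intersection; the truncation at 0 covers the case that they are disjoint.\<close>

lemma has_integral_indicator_Icc:
  fixes p q u v :: real
  shows "((indicator {u..v} :: real \<Rightarrow> real) has_integral max 0 (min q v - max p u)) {p..q}"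
proof -
  have "((\<lambda>t. 1::real) has_integral max 0 (min q v - max p u)) {max p u..min q v}"
    using has_integral_const_real[of "1::real" "max p u" "min q v"] by (simp add: max_def)
  then have "((\<lambda>t. if t \<in> {max p u..min q v} then 1 else 0::real)
      has_integral max 0 (min q v - max p u)) {p..q}"
    by (subst has_integral_restrict) auto
  then show ?thesis
    by (rule has_integral_eq[rotated]) (auto simp: indicator_def)
qed

lemma integral_rate:
  "integral {p..q} (\<lambda>t. \<beta> - \<alpha> * (num_present N a d t - 1))
    = (\<beta> + \<alpha>) * max 0 (q - p)
      - \<alpha> * (\<Sum>j=1..N. max 0 (min q (d\<langle>j\<rangle>) - max p (a\<langle>j\<rangle>)))"
proof -
  have "((\<lambda>t. num_present N a d t) has_integral
      (\<Sum>j=1..N. max 0 (min q (d\<langle>j\<rangle>) - max p (a\<langle>j\<rangle>)))) {p..q}"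
    unfolding num_present_def by (intro has_integral_sum has_integral_indicator_Icc) simp
  \<comment> \<open>The rate is rewritten so that its constant part \<beta> + \<alpha> is separated
    from the number of users present.\<close>
  then have "((\<lambda>t. (\<beta> + \<alpha>) - \<alpha> * num_present N a d t) has_integral
      (\<beta> + \<alpha>) * max 0 (q - p)
      - \<alpha> * (\<Sum>j=1..N. max 0 (min q (d\<langle>j\<rangle>) - max p (a\<langle>j\<rangle>)))) {p..q}"
    using has_integral_const_real[of "\<beta> + \<alpha>" p q]
    by (intro has_integral_diff has_integral_mult_right) (simp_all add: max_def mult.commute)
  then show ?thesis
    by (intro integral_unique) (simp add: algebra_simps)
qed

section \<open>Users overlapping with a fixed user\<close>

locale ordered_users =
  fixes N :: nat and a d :: "real vec"
  assumes arrival_step: "\<forall>i\<in>{1..<N}. a\<langle>i\<rangle> \<le> a\<langle>i + 1\<rangle>"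
    and departure_step: "\<forall>i\<in>{1..<N}. d\<langle>i\<rangle> \<le> d\<langle>i + 1\<rangle>"
    and arrival_less_departure: "\<forall>i\<in>{1..N}. a\<langle>i\<rangle> < d\<langle>i\<rangle>"
begin

lemma arrival_mono: "1 \<le> i \<Longrightarrow> i \<le> j \<Longrightarrow> j \<le> N \<Longrightarrow> a\<langle>i\<rangle> \<le> a\<langle>j\<rangle>"
  using le_of_steps[of 1 N "\<lambda>i. a\<langle>i\<rangle>"] arrival_step by blast

lemma departure_mono: "1 \<le> i \<Longrightarrow> i \<le> j \<Longrightarrow> j \<le> N \<Longrightarrow> d\<langle>i\<rangle> \<le> d\<langle>j\<rangle>"
  using le_of_steps[of 1 N "\<lambda>i. d\<langle>i\<rangle>"] departure_step by blast

context
  fixes i assumes i: "i \<in> {1..N}"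
begin

text \<open>Since \<open>a\<langle>i\<rangle> < d\<langle>i\<rangle>\<close>, the set in the
  definition contains i. It is thus finite and nonempty, and its maximum is one of its
  members.\<close>

lemma k_index_bounds: "i \<le> k_index N a d i" "k_index N a d i \<le> N"
  and arrival_k_index: "a\<langle>k_index N a d i\<rangle> \<le> d\<langle>i\<rangle>"
proof -
  let ?S = "{k \<in> {1..N}. a\<langle>k\<rangle> \<le> d\<langle>i\<rangle>}"
  have "finite ?S" "i \<in> ?S" using i arrival_less_departure by (auto intro: less_imp_le)
  then have "i \<le> Max ?S" "Max ?S \<in> ?S" using Max_ge[of ?S i] Max_in[of ?S] by blast+
  then show "i \<le> k_index N a d i" "k_index N a d i \<le> N" "a\<langle>k_index N a d i\<rangle> \<le> d\<langle>i\<rangle>"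
    unfolding k_index_def by auto
qed

lemma h_index_bounds: "1 \<le> h_index N a d i" "h_index N a d i \<le> i"
  and departure_h_index: "a\<langle>i\<rangle> \<le> d\<langle>h_index N a d i\<rangle>"
proof -
  let ?S = "{h \<in> {1..N}. d\<langle>h\<rangle> \<ge> a\<langle>i\<rangle>}"
  have "finite ?S" "i \<in> ?S" using i arrival_less_departure by (auto intro: less_imp_le)
  then have "Min ?S \<le> i" "Min ?S \<in> ?S" using Min_le[of ?S i] Min_in[of ?S] by blast+
  then show "1 \<le> h_index N a d i" "h_index N a d i \<le> i" "a\<langle>i\<rangle> \<le> d\<langle>h_index N a d i\<rangle>"
    unfolding h_index_def by auto
qed

text \<open>As arrivals are ordered, the set whose maximum is taken is downward closed, hence all of
  1, ..., \<open>k_index N a d i\<close>. Dually, the set behind \<open>h_index\<close> is a final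
  segment of the users.\<close>

lemma arrival_le_departure_iff:
  assumes "j \<in> {1..N}"
  shows "a\<langle>j\<rangle> \<le> d\<langle>i\<rangle> \<longleftrightarrow> j \<le> k_index N a d i"
proof
  assume "a\<langle>j\<rangle> \<le> d\<langle>i\<rangle>"
  then show "j \<le> k_index N a d i"
    unfolding k_index_def using assms by (intro Max_ge) auto
next
  assume "j \<le> k_index N a d i"
  then show "a\<langle>j\<rangle> \<le> d\<langle>i\<rangle>"
    using arrival_mono[of j "k_index N a d i"] assms k_index_bounds arrival_k_index by auto
qed

lemma departure_ge_arrival_iff:
  assumes "j \<in> {1..N}"
  shows "a\<langle>i\<rangle> \<le> d\<langle>j\<rangle> \<longleftrightarrow> h_index N a d i \<le> j"
proof
  assume "a\<langle>i\<rangle> \<le> d\<langle>j\<rangle>"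
  then show "h_index N a d i \<le> j"
    unfolding h_index_def using assms by (intro Min_le) auto
next
  assume "h_index N a d i \<le> j"
  then show "a\<langle>i\<rangle> \<le> d\<langle>j\<rangle>"
    using departure_mono[of "h_index N a d i" j] assms h_index_bounds departure_h_index by auto
qed

text \<open>The three groups on the right are the contributions of user i, of the earlier users from
  h on, and of the later users up to k.\<close>

lemma sum_overlaps:
  defines "h \<equiv> h_index N a d i" and "k \<equiv> k_index N a d i"
  shows "(\<Sum>j=1..N. max 0 (min (d\<langle>i\<rangle>) (d\<langle>j\<rangle>) - max (a\<langle>i\<rangle>) (a\<langle>j\<rangle>)))
    = (d\<langle>i\<rangle> - a\<langle>i\<rangle>) + ((\<Sum>j=h..i - 1. d\<langle>j\<rangle>) - (real i - real h) * a\<langle>i\<rangle>)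
      + ((real k - real i) * d\<langle>i\<rangle> - (\<Sum>j=i + 1..k. a\<langle>j\<rangle>))"
proof -
  define g where "g = (\<lambda>j. max 0 (min (d\<langle>i\<rangle>) (d\<langle>j\<rangle>) - max (a\<langle>i\<rangle>) (a\<langle>j\<rangle>)))"
  have h: "1 \<le> h" "h \<le> i" and k: "i \<le> k" "k \<le> N"
    unfolding h_def k_def using h_index_bounds k_index_bounds by auto
  \<comment> \<open>Below h, user j has left before i arrives; above k, user j arrives after i has
    left. Either way the difference is negative and the truncation gives 0.\<close>
  have outside: "g j = 0" if "j \<in> {1..N} - {h..k}" for j
  proof (cases "j < h")
    case True
    then have "d\<langle>j\<rangle> < a\<langle>i\<rangle>"
      using departure_ge_arrival_iff[of j] that unfolding h_def by auto
    then show ?thesis unfolding g_def by simp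
  next
    case False
    then have "d\<langle>i\<rangle> < a\<langle>j\<rangle>"
      using arrival_le_departure_iff[of j] that unfolding k_def by auto
    then show ?thesis unfolding g_def by simp
  qed
  \<comment> \<open>Order of arrivals and departures decides the \<open>max\<close> and the
    \<open>min\<close>; \<open>h \<le> j\<close> makes the difference nonnegative, so the truncation
    has no effect.\<close>
  have earlier: "g j = d\<langle>j\<rangle> - a\<langle>i\<rangle>" if "j \<in> {h..i - 1}" for j
  proof -
    have "1 \<le> j" "j \<le> i" "j \<le> N" "h \<le> j" using that i h by auto
    then show ?thesis
      using arrival_mono[of j i] departure_mono[of j i] departure_ge_arrival_iff[of j] i
      unfolding g_def h_def by (simp add: max_def)
  qed
  have later: "g j = d\<langle>i\<rangle> - a\<langle>j\<rangle>" if "j \<in> {i + 1..k}" for j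
  proof -
    have "1 \<le> j" "i \<le> j" "j \<le> N" "j \<le> k" using that i k by auto
    then show ?thesis
      using arrival_mono[of i j] departure_mono[of i j] arrival_le_departure_iff[of j] i
      unfolding g_def k_def by (simp add: max_def)
  qed
  have self: "g i = d\<langle>i\<rangle> - a\<langle>i\<rangle>"
    using arrival_less_departure i unfolding g_def by (auto simp: max_def less_imp_le)
  \<comment> \<open>Here \<open>1 \<le> h \<le> i\<close> ensures that \<open>i - 1\<close> is a
    true predecessor, so the first range is empty exactly when h = i.\<close>
  have split: "{h..k} = insert i ({h..i - 1} \<union> {i + 1..k})"
    using h k by auto
  have "sum g {1..N} = sum g {h..k}"
    using h k outside by (intro sum.mono_neutral_right) auto
  also have "\<dots> = g i + (sum g {h..i - 1} + sum g {i + 1..k})"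
    unfolding split using h by (subst sum.insert) (auto simp: sum.union_disjoint)
  also have "sum g {h..i - 1} = (\<Sum>j=h..i - 1. d\<langle>j\<rangle>) - (real i - real h) * a\<langle>i\<rangle>"
    using earlier h by (simp add: sum_subtractf of_nat_diff)
  also have "sum g {i + 1..k} = (real k - real i) * d\<langle>i\<rangle> - (\<Sum>j=i + 1..k. a\<langle>j\<rangle>)"
    using later k by (simp add: sum_subtractf of_nat_diff)
  finally show ?thesis unfolding g_def[symmetric] self by simp
qed

text \<open>The i-th integral is identically the left side of the i-th linear equation, which makes
  the systems equivalent equation by equation. The overlap of user i with itself reduces the
  coefficient \<beta> + \<alpha> of \<open>d\<langle>i\<rangle> - a\<langle>i\<rangle>\<close> to
  \<beta>.\<close>

lemma integral_service:
  defines "h \<equiv> h_index N a d i" and "k \<equiv> k_index N a d i"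
  shows "integral {a\<langle>i\<rangle>..d\<langle>i\<rangle>} (\<lambda>t. \<beta> - \<alpha> * (num_present N a d t - 1))
    = (\<beta> - \<alpha> * (real k - real i)) * d\<langle>i\<rangle> - \<alpha> * (\<Sum>j=h..i - 1. d\<langle>j\<rangle>)
      - (\<beta> - \<alpha> * (real i - real h)) * a\<langle>i\<rangle> + \<alpha> * (\<Sum>j=i + 1..k. a\<langle>j\<rangle>)"
proof -
  have "max 0 (d\<langle>i\<rangle> - a\<langle>i\<rangle>) = d\<langle>i\<rangle> - a\<langle>i\<rangle>"
    using arrival_less_departure i by (auto simp: max_def less_imp_le)
  then show ?thesis
    unfolding integral_rate sum_overlaps h_def k_def by (simp add: algebra_simps)
qed

end

lemma dynamics_iff_linear: "dynamics_system N \<alpha> \<beta> a d \<longleftrightarrow> linear_system N \<alpha> \<beta> a d"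
  unfolding dynamics_system_def linear_system_def
  by (intro ball_cong refl) (simp only: integral_service eq_commute)

end

section \<open>Rows of the matrices as linear equations\<close>

lemma mult_mat_vec_user_entry:
  assumes "v \<in> carrier_vec N" "i \<in> {1..N}"
  shows "(mat N N f *\<^sub>v v)\<langle>i\<rangle> = (\<Sum>j=1..N. f (i - 1, j - 1) * v\<langle>j\<rangle>)"
proof -
  have "(mat N N f *\<^sub>v v)\<langle>i\<rangle> = (\<Sum>c=0..<N. f (i - 1, c) * v $ c)"
    using assms by (auto simp: scalar_prod_def intro!: sum.cong)
  also have "\<dots> = (\<Sum>j=1..N. f (i - 1, j - 1) * v\<langle>j\<rangle>)"
    by (rule sum.reindex_bij_witness[of _ "\<lambda>j. j - 1" Suc]) auto
  finally show ?thesis .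
qed

text \<open>Common shape of the rows of both matrices: a diagonal entry x, and a constant y on a
  block S that avoids the diagonal.\<close>

lemma sum_diagonal_plus_const:
  fixes f :: "'i \<Rightarrow> real"
  assumes "finite I" "i \<in> I" "S \<subseteq> I" "i \<notin> S"
  shows "(\<Sum>j\<in>I. (if i = j then x else if j \<in> S then y else 0) * f j) = x * f i + y * sum f S"
proof -
  \<comment> \<open>As i lies outside S, the two cases exclude each other and the nested conditional
    becomes a sum.\<close>
  have "(\<Sum>j\<in>I. (if i = j then x else if j \<in> S then y else 0) * f j)
      = (\<Sum>j\<in>I. (if j = i then x * f j else 0) + (if j \<in> S then y * f j else 0))"
    using assms(4) by (intro sum.cong) auto
  also have "\<dots> = x * f i + (\<Sum>j\<in>I. if j \<in> S then y * f j else 0)"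
    using assms(1,2) by (simp add: sum.distrib)
  also have "(\<Sum>j\<in>I. if j \<in> S then y * f j else 0) = y * sum f S"
    using assms(1,3) by (simp add: sum.inter_restrict[symmetric] Int_absorb1 sum_distrib_left)
  finally show ?thesis .
qed

context ordered_users
begin

lemma D_matrix_mult_entry:
  assumes "v \<in> carrier_vec N" and i: "i \<in> {1..N}"
  shows "(D_matrix N \<alpha> \<beta> a d *\<^sub>v v)\<langle>i\<rangle>
    = (\<beta> - \<alpha> * (real (k_index N a d i) - real i)) * v\<langle>i\<rangle>
      - \<alpha> * (\<Sum>j=h_index N a d i..i - 1. v\<langle>j\<rangle>)"
proof -
  let ?x = "\<beta> - \<alpha> * (real (k_index N a d i) - real i)"
  have "(D_matrix N \<alpha> \<beta> a d *\<^sub>v v)\<langle>i\<rangle>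
      = (\<Sum>j\<in>{1..N}. (if i = j then ?x
          else if j \<in> {h_index N a d i..i - 1} then - \<alpha> else 0) * v\<langle>j\<rangle>)"
    unfolding D_matrix_def mult_mat_vec_user_entry[OF assms]
    using i by (intro sum.cong) (auto simp: Let_def)
  \<comment> \<open>The block left of the diagonal stays within the users 1, ..., N because
    \<open>h_index N a d i\<close> is at least 1.\<close>
  also have "\<dots> = ?x * v\<langle>i\<rangle> + - \<alpha> * (\<Sum>j=h_index N a d i..i - 1. v\<langle>j\<rangle>)"
    using i h_index_bounds[OF i] by (intro sum_diagonal_plus_const) auto
  finally show ?thesis by simp
qed

lemma A_matrix_mult_entry:
  assumes "v \<in> carrier_vec N" and i: "i \<in> {1..N}"
  shows "(A_matrix N \<alpha> \<beta> a d *\<^sub>v v)\<langle>i\<rangle>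
    = (\<beta> - \<alpha> * (real i - real (h_index N a d i))) * v\<langle>i\<rangle>
      - \<alpha> * (\<Sum>j=i + 1..k_index N a d i. v\<langle>j\<rangle>)"
proof -
  let ?x = "\<beta> - \<alpha> * (real i - real (h_index N a d i))"
  have "(A_matrix N \<alpha> \<beta> a d *\<^sub>v v)\<langle>i\<rangle>
      = (\<Sum>j\<in>{1..N}. (if i = j then ?x
          else if j \<in> {i + 1..k_index N a d i} then - \<alpha> else 0) * v\<langle>j\<rangle>)"
    unfolding A_matrix_def mult_mat_vec_user_entry[OF assms]
    using i by (intro sum.cong) (auto simp: Let_def)
  also have "\<dots> = ?x * v\<langle>i\<rangle> + - \<alpha> * (\<Sum>j=i + 1..k_index N a d i. v\<langle>j\<rangle>)"
    using i k_index_bounds[OF i] by (intro sum_diagonal_plus_const) auto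
  finally show ?thesis by simp
qed

lemma linear_iff_matrix:
  assumes "a \<in> carrier_vec N" "d \<in> carrier_vec N"
  shows "linear_system N \<alpha> \<beta> a d \<longleftrightarrow>
    D_matrix N \<alpha> \<beta> a d *\<^sub>v d - A_matrix N \<alpha> \<beta> a d *\<^sub>v a = vec N (\<lambda>_. 1)"
    (is "_ \<longleftrightarrow> ?w = _")
proof -
  have dims: "dim_vec (D_matrix N \<alpha> \<beta> a d *\<^sub>v d) = N" "dim_vec (A_matrix N \<alpha> \<beta> a d *\<^sub>v a) = N"
    by (simp_all add: D_matrix_def A_matrix_def)
  have "?w = vec N (\<lambda>_. 1) \<longleftrightarrow> (\<forall>r<N. ?w $ r = 1)"
    using dims by (auto simp: vec_eq_iff)
  also have "\<dots> \<longleftrightarrow> (\<forall>i\<in>{1..N}. ?w\<langle>i\<rangle> = 1)"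
  proof (intro iffI allI impI ballI)
    fix r assume "\<forall>i\<in>{1..N}. ?w\<langle>i\<rangle> = 1" "r < N"
    \<comment> \<open>Entry r belongs to user r + 1. Without \<open>index_minus_vec\<close>, the
      entry of \<open>?w\<close> stays whole and matches the hypothesis.\<close>
    then show "?w $ r = 1" by (auto dest!: bspec[of _ _ "r + 1"] simp del: index_minus_vec)
  qed auto
  also have "\<dots> \<longleftrightarrow> linear_system N \<alpha> \<beta> a d"
    unfolding linear_system_def
  proof (intro ball_cong refl)
    fix i assume i: "i \<in> {1..N}"
    then have entry: "?w\<langle>i\<rangle> = (D_matrix N \<alpha> \<beta> a d *\<^sub>v d)\<langle>i\<rangle> - (A_matrix N \<alpha> \<beta> a d *\<^sub>v a)\<langle>i\<rangle>"
      using dims by (intro index_minus_vec) auto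
    show "(?w\<langle>i\<rangle> = 1) \<longleftrightarrow>
        (\<beta> - \<alpha> * (real (k_index N a d i) - real i)) * d\<langle>i\<rangle>
        - \<alpha> * (\<Sum>j=h_index N a d i..i - 1. d\<langle>j\<rangle>)
        - (\<beta> - \<alpha> * (real i - real (h_index N a d i))) * a\<langle>i\<rangle>
        + \<alpha> * (\<Sum>j=i + 1..k_index N a d i. a\<langle>j\<rangle>) = 1"
      unfolding entry D_matrix_mult_entry[OF assms(2) i] A_matrix_mult_entry[OF assms(1) i]
      \<comment> \<open>Subtracting the row of A turns its off-diagonal -\<alpha> into the +\<alpha>
        of the linear equation; only the bracketing differs.\<close>
      by (simp only: diff_diff_eq2 diff_add_eq)
  qed
  finally show ?thesis by blast
qed

end

theorem proposition3p1:
  fixes N :: nat and \<alpha> \<beta> :: real and a d :: "real vec"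
  assumes "N \<ge> 1"
    and "\<alpha> > 0" and "\<beta> > 0"
    and "real N < \<beta> / \<alpha> + 1"
    and "a \<in> carrier_vec N" and "d \<in> carrier_vec N"
    and "\<forall>i\<in>{1..<N}. a\<langle>i\<rangle> \<le> a\<langle>i + 1\<rangle>"
    and "\<forall>i\<in>{1..<N}. d\<langle>i\<rangle> \<le> d\<langle>i + 1\<rangle>"
    and "\<forall>i\<in>{1..N}. a\<langle>i\<rangle> < d\<langle>i\<rangle>"
  shows "(dynamics_system N \<alpha> \<beta> a d \<longleftrightarrow> linear_system N \<alpha> \<beta> a d) \<and>
         (dynamics_system N \<alpha> \<beta> a d \<longleftrightarrow>
            D_matrix N \<alpha> \<beta> a d *\<^sub>v d - A_matrix N \<alpha> \<beta> a d *\<^sub>v a = vec N (\<lambda>_. 1))"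
proof -
  interpret ordered_users N a d
    using assms(7-9) by unfold_locales
  show ?thesis
    using dynamics_iff_linear linear_iff_matrix[OF assms(5,6)] by simp
qed

end
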